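(* Let $j$ be the imaginary unit ($j^2=-1$), let $$\mathbf{\Phi} = \begin{pmatrix} 0 & j \\ j & 0 \end{pmatrix}, \qquad \sigma_1 = \begin{pmatrix} 0 & 1 \\ 1 & 0 \end{pmatrix}.$$ Then for every integer $k$, with $m = 1+4k$, $$e^{m\frac{\pi}{2}\mathbf{\Phi}} = \mathbf{\Phi} \qquad\text{and}\qquad \sigma_1 = -j\, e^{m\frac{\pi}{2}\mathbf{\Phi}}.$$
   Context: For a square complex matrix $\mathbf{A}$, the matrix exponential is $e^{\mathbf{A}} = \sum_{n=0}^{+\infty} \frac{\mathbf{A}^n}{n!}$. The matrix $\mathbf{\Phi}$ here is the case $\alpha=1$ of the matrix $\begin{pmatrix} 0 & j \\ j\alpha^2 & 0 \end{pmatrix}$ ($\alpha$ a nonzero real number), called the imaginary unit matrix; $\sigma_1$ is the first Pauli matrix. *)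

theory Defs
  imports "HOL-Analysis.Analysis"
begin

(* Multiplication, and hence power and exp, on the type 'a^'n^'n is entrywise in the library,
   so powers with respect to the matrix product and the exponential series are defined here. *)

primrec matrix_power :: "'a::semiring_1 ^'n^'n \<Rightarrow> nat \<Rightarrow> 'a ^'n^'n" where
  "matrix_power A 0 = mat 1"
| "matrix_power A (Suc n) = A ** matrix_power A n"

definition matrix_exp :: "complex ^'n^'n \<Rightarrow> complex ^'n^'n" where
  "matrix_exp A = (\<Sum>n. (1 / fact n) *\<^sub>R matrix_power A n)"

definition matrix_scale :: "'a::times \<Rightarrow> 'a ^'n^'m \<Rightarrow> 'a ^'n^'m" where
  "matrix_scale c A = (\<chi> i. c *s (A $ i))"

definition Phi :: "complex ^2^2" where
  "Phi = vector [vector [0, \<i>], vector [\<i>, 0]]"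

definition sigma1 :: "complex ^2^2" where
  "sigma1 = vector [vector [0, 1], vector [1, 0]]"

(* The exponential series converges for every matrix, so the suminf in matrix_exp
   is always the genuine limit. *)

lemma norm_matrix_power_entry:
  fixes A :: "complex ^'n^'n"
  shows "norm (matrix_power A n $ i $ j) \<le> (\<Sum>i\<in>UNIV. \<Sum>j\<in>UNIV. norm (A $ i $ j)) ^ n"
proof (induction n arbitrary: i)
  case 0
  show ?case by (simp add: mat_def)
next
  case (Suc n)
  let ?M = "\<Sum>i\<in>UNIV. \<Sum>j\<in>UNIV. norm (A $ i $ j)"
  have M: "?M \<ge> 0" by (intro sum_nonneg) auto
  have "norm (matrix_power A (Suc n) $ i $ j)
      \<le> (\<Sum>k\<in>UNIV. norm (A $ i $ k * matrix_power A n $ k $ j))"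
    by (simp add: matrix_matrix_mult_def norm_sum)
  also have "\<dots> \<le> (\<Sum>k\<in>UNIV. norm (A $ i $ k) * ?M ^ n)"
    by (intro sum_mono) (simp add: norm_mult mult_left_mono Suc.IH)
  also have "\<dots> = (\<Sum>k\<in>UNIV. norm (A $ i $ k)) * ?M ^ n"
    by (simp add: sum_distrib_right)
  also have "\<dots> \<le> ?M * ?M ^ n"
    by (intro mult_right_mono zero_le_power M
        member_le_sum[where f = "\<lambda>i. \<Sum>k\<in>UNIV. norm (A $ i $ k)"] sum_nonneg) auto
  finally show ?case by simp
qed

lemma summable_matrix_exp:
  fixes A :: "complex ^'n^'n"
  shows "summable (\<lambda>n. (1 / fact n) *\<^sub>R matrix_power A n)"
proof -
  let ?M = "\<Sum>i\<in>UNIV. \<Sum>j\<in>UNIV. norm (A $ i $ j)"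
  have entry: "summable (\<lambda>n. ((1 / fact n) *\<^sub>R matrix_power A n) $ i $ j)" for i j
  proof (rule summable_comparison_test')
    show "summable (\<lambda>n. inverse (fact n) * ?M ^ n)" by (rule summable_exp)
    show "norm (((1 / fact n) *\<^sub>R matrix_power A n) $ i $ j) \<le> inverse (fact n) * ?M ^ n"
      if "n \<ge> 0" for n
      using mult_left_mono[OF norm_matrix_power_entry[of A n i j], of "inverse (fact n)"]
      by (simp add: divide_inverse)
  qed
  have "(\<lambda>n. (1 / fact n) *\<^sub>R matrix_power A n)
      sums (\<chi> i j. \<Sum>n. ((1 / fact n) *\<^sub>R matrix_power A n) $ i $ j)"
    unfolding sums_def
  proof (intro vec_tendstoI)
    fix i j
    show "(\<lambda>N. (\<Sum>n<N. (1 / fact n) *\<^sub>R matrix_power A n) $ i $ j) \<longlonglongrightarrow>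
        (\<chi> i j. \<Sum>n. ((1 / fact n) *\<^sub>R matrix_power A n) $ i $ j) $ i $ j"
      using summable_LIMSEQ[OF entry[of i j]] by simp
  qed
  then show ?thesis by (rule sums_summable)
qed

end

theory Submission
  imports Defs
begin

text \<open>
  \<^const>\<open>Phi\<close> is \<open>\<i>\<close> times the involution \<^const>\<open>sigma1\<close>, whose eigenvectors \<open>(1, 1)\<close> and \<open>(1, -1)\<close>
  have the eigenvalues \<open>1\<close> and \<open>-1\<close>. The matrices that are diagonal in this basis form an algebra
  isomorphic to \<open>\<complex> \<times> \<complex>\<close> (lemma \<open>sigma1_spectral_mult\<close>), so their exponential is computed on the
  two eigenvalues separately (lemma \<open>matrix_exp_sigma1_spectral\<close>). Now \<open>t \<Phi>\<close> has the eigenvalues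
  \<open>\<plusminus>\<i> t\<close>; for \<open>t = m \<pi>/2\<close> with \<open>m = 1 + 4 k\<close> their exponentials are \<open>\<plusminus>\<i>\<close>, which are again the
  eigenvalues of \<open>\<Phi>\<close>. The second identity is the first one multiplied by \<open>-\<i>\<close>.
\<close>

text \<open>
  The matrix with eigenvalue \<open>a\<close> at \<open>(1, 1)\<close> and \<open>b\<close> at \<open>(1, -1)\<close>, that is \<open>f(\<sigma>\<^sub>1)\<close> for any function \<open>f\<close>
  with \<open>f(1) = a\<close> and \<open>f(-1) = b\<close>.
\<close>
definition sigma1_spectral :: "complex \<Rightarrow> complex \<Rightarrow> complex^2^2" where
  "sigma1_spectral a b = (\<chi> i j. if i = j then (a + b) / 2 else (a - b) / 2)"

lemma mat_1_eq_sigma1_spectral: "mat 1 = sigma1_spectral 1 1"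
  by (simp add: sigma1_spectral_def mat_def vec_eq_iff)

lemma scaleR_Phi_eq_sigma1_spectral: "t *\<^sub>R Phi = sigma1_spectral (\<i> * t) (- \<i> * t)"
  by (simp add: sigma1_spectral_def Phi_def vec_eq_iff forall_2 scaleR_conv_of_real[where 'a = complex])

lemma sigma1_spectral_mult:
  "sigma1_spectral a b ** sigma1_spectral c d = sigma1_spectral (a * c) (b * d)"
  by (simp add: sigma1_spectral_def matrix_matrix_mult_def vec_eq_iff forall_2 sum_2 field_simps)

lemma matrix_power_sigma1_spectral:
  "matrix_power (sigma1_spectral a b) n = sigma1_spectral (a ^ n) (b ^ n)"
  by (induction n) (simp_all add: mat_1_eq_sigma1_spectral sigma1_spectral_mult)

lemma scaleR_sigma1_spectral: "r *\<^sub>R sigma1_spectral a b = sigma1_spectral (r *\<^sub>R a) (r *\<^sub>R b)"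
  by (simp add: sigma1_spectral_def vec_eq_iff scaleR_conv_of_real[where 'a = complex] algebra_simps diff_divide_distrib add_divide_distrib)

lemma sum_sigma1_spectral:
  "(\<Sum>n\<in>A. sigma1_spectral (f n) (g n)) = sigma1_spectral (\<Sum>n\<in>A. f n) (\<Sum>n\<in>A. g n)"
  by (simp add: sigma1_spectral_def vec_eq_iff sum.distrib sum_subtractf flip: sum_divide_distrib)

lemma tendsto_sigma1_spectral:
  assumes "(f \<longlongrightarrow> a) F" "(g \<longlongrightarrow> b) F"
  shows "((\<lambda>x. sigma1_spectral (f x) (g x)) \<longlongrightarrow> sigma1_spectral a b) F"
proof (intro vec_tendstoI)
  fix i j
  show "((\<lambda>x. sigma1_spectral (f x) (g x) $ i $ j) \<longlongrightarrow> sigma1_spectral a b $ i $ j) F"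
    using assms by (cases "i = j") (auto simp: sigma1_spectral_def intro!: tendsto_intros)
qed

lemma matrix_exp_sigma1_spectral:
  "matrix_exp (sigma1_spectral a b) = sigma1_spectral (exp a) (exp b)"
proof -
  have "(\<lambda>n. sigma1_spectral (a ^ n /\<^sub>R fact n) (b ^ n /\<^sub>R fact n)) sums sigma1_spectral (exp a) (exp b)"
    using exp_converges[of a] exp_converges[of b]
    by (simp add: sums_def sum_sigma1_spectral tendsto_sigma1_spectral)
  then show ?thesis
    by (simp add: matrix_exp_def matrix_power_sigma1_spectral scaleR_sigma1_spectral
        divide_inverse sums_iff)
qed

text \<open>Euler's formula for \<^const>\<open>Phi\<close>, kept in terms of its two eigenvalues.\<close>
lemma matrix_exp_scaleR_Phi: "matrix_exp (t *\<^sub>R Phi) = sigma1_spectral (cis t) (cis (- t))"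
  by (simp add: scaleR_Phi_eq_sigma1_spectral matrix_exp_sigma1_spectral cis_conv_exp)

lemma cis_quarter_turns:
  fixes k :: int
  shows "cis (real_of_int (1 + 4 * k) * (pi / 2)) = \<i>"
proof -
  have "cis (real_of_int (1 + 4 * k) * (pi / 2)) = cis (pi / 2) * cis (2 * pi * real_of_int k)"
    unfolding cis_mult by (rule arg_cong[where f = cis]) (simp add: algebra_simps)
  then show ?thesis
    by (simp add: cis_multiple_2pi)
qed

theorem mainTheorem3:
  fixes k m :: int
  assumes "m = 1 + 4 * k"
  shows "matrix_exp ((real_of_int m * (pi / 2)) *\<^sub>R Phi) = Phi \<and>
    sigma1 = matrix_scale (- \<i>) (matrix_exp ((real_of_int m * (pi / 2)) *\<^sub>R Phi))"
proof -
  let ?t = "real_of_int m * (pi / 2)"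
  have "cis ?t = \<i>"
    unfolding assms by (rule cis_quarter_turns)
  moreover from this have "cis (- ?t) = - \<i>"
    by (simp flip: cis_cnj)
  ultimately have "matrix_exp (?t *\<^sub>R Phi) = sigma1_spectral \<i> (- \<i>)"
    by (simp only: matrix_exp_scaleR_Phi)
  also have "\<dots> = Phi"
    using scaleR_Phi_eq_sigma1_spectral[of 1] by simp
  finally have "matrix_exp (?t *\<^sub>R Phi) = Phi" .
  moreover have "sigma1 = matrix_scale (- \<i>) Phi"
    by (simp add: sigma1_def Phi_def matrix_scale_def vec_eq_iff forall_2)
  ultimately show ?thesis by simp
qed

end
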